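(* Let $I\subseteq\mathbb{R}$ be a nonempty open interval, let $f:I\to\mathbb{R}$ be a continuous and strictly increasing function, and let $(\xi_n)_{n\in\mathbb{N}}$ be a sequence of independent and identically distributed random variables with values in $I$ such that $\mathbb{E}((f(\xi_1))^4)<\infty$. Let $\alpha:(f(I)-f(I))\to\mathbb{R}_+$, $\alpha(x):=x^4$, and let $L:I\to\mathbb{R}$ be a function such that $L\circ f^{-1}:f(I)\to\mathbb{R}$ is strongly $\alpha$-convex and $\mathbb{E}(|L(\xi_1)|)<\infty$. Then (i) $\mathbb{E}\big(L(\mathscr{A}_n^{f}(\xi_1,\ldots,\xi_n))\big)\in[-\infty,\infty)$ for all $n\in\mathbb{N}\setminus\{1\}$; (ii) for each $n\in\mathbb{N}\setminus\{1\}$, $$\mathbb{E}\big(L(\mathscr{A}_n^{f}(\xi_1,\ldots,\xi_n))\big)\leq\mathbb{E}\big(L(\mathscr{A}_{n-1}^{f}(\xi_1,\ldots,\xi_{n-1}))\big)-\frac{1}{(n-1)^3n^3}\Big((n^2-3n+3)M_4+3(2n-3)M_2^2\Big),$$ where $M_k:=\mathbb{E}\big((f(\xi_1)-\mathbb{E}(f(\xi_1)))^k\big)$ for $k\in\{2,4\}$.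
   Context: $\mathbb{N}$ is the set of positive integers and $\mathbb{R}_+=[0,\infty)$. For a nondegenerate interval $J\subseteq\mathbb{R}$, $J-J:=\{x-y: x,y\in J\}$. Quasi-arithmetic mean: for a nonempty open interval $I$, a continuous strictly increasing $f:I\to\mathbb{R}$ with inverse $f^{-1}:f(I)\to I$, and $n\in\mathbb{N}$, $\mathscr{A}_n^{f}:I^n\to I$ is $\mathscr{A}_n^{f}(x_1,\ldots,x_n):=f^{-1}\big(\frac1n\sum_{i=1}^n f(x_i)\big)$. Strong $\alpha$-convexity: let $J\subseteq\mathbb{R}$ be a nondegenerate interval and $\alpha:(J-J)\to\mathbb{R}_+$ an even function. A function $\Lambda:J\to\mathbb{R}$ is strongly $\alpha$-convex if $\Lambda(tx+(1-t)y)\leq t\Lambda(x)+(1-t)\Lambda(y)-t\,\alpha((1-t)(x-y))-(1-t)\,\alpha(t(y-x))$ for all $x,y\in J$ and $t\in[0,1]$. An expectation is said to lie in $[-\infty,\infty)$ when the positive part is integrable, the expectation being $-\infty$ if the negative part is not integrable; the inequality in (ii) is understood in $[-\infty,\infty)$. *)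

theory Defs
  imports "HOL-Probability.Probability"
begin

text \<open>Only \<open>x 1, \<dots>, x n\<close> matter; the inverse of \<open>f\<close> is taken on \<open>f ` I\<close>.\<close>
definition quasi_arith_mean ::
  "real set \<Rightarrow> (real \<Rightarrow> real) \<Rightarrow> nat \<Rightarrow> (nat \<Rightarrow> real) \<Rightarrow> real" where
  "quasi_arith_mean I f n x = the_inv_into I f ((1 / real n) * (\<Sum>i = 1..n. f (x i)))"

text \<open>Intended for a nondegenerate interval \<open>J\<close> and an \<open>\<alpha>\<close> that is even and nonnegative on the
  set of differences of elements of \<open>J\<close>; values of \<open>\<alpha>\<close> and \<open>\<Lambda>\<close> elsewhere are irrelevant.\<close>
definition strongly_convex_wrt ::
  "(real \<Rightarrow> real) \<Rightarrow> real set \<Rightarrow> (real \<Rightarrow> real) \<Rightarrow> bool" where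
  "strongly_convex_wrt \<alpha> J \<Lambda> \<longleftrightarrow>
     (\<forall>x\<in>J. \<forall>y\<in>J. \<forall>t\<in>{0..1}.
        \<Lambda> (t * x + (1 - t) * y)
          \<le> t * \<Lambda> x + (1 - t) * \<Lambda> y
             - t * \<alpha> ((1 - t) * (x - y)) - (1 - t) * \<alpha> (t * (y - x)))"

definition expectation_below_top :: "'a measure \<Rightarrow> ('a \<Rightarrow> real) \<Rightarrow> bool" where
  "expectation_below_top M X \<longleftrightarrow>
     X \<in> borel_measurable M \<and> integrable M (\<lambda>\<omega>. max 0 (X \<omega>))"

text \<open>Integral of the positive part minus integral of the negative part (\<open>ennreal\<close> sends negative
  reals to \<open>0\<close>). Meaningful only if one of the two is finite, e.g. under
  \<open>expectation_below_top M X\<close>, where the value is \<open>-\<infinity>\<close> iff the negative part is not integrable.\<close>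
definition ext_expectation :: "'a measure \<Rightarrow> ('a \<Rightarrow> real) \<Rightarrow> ereal" where
  "ext_expectation M X =
     enn2ereal (\<integral>\<^sup>+\<omega>. ennreal (X \<omega>) \<partial>M) - enn2ereal (\<integral>\<^sup>+\<omega>. ennreal (- X \<omega>) \<partial>M)"

definition central_moment :: "'a measure \<Rightarrow> ('a \<Rightarrow> real) \<Rightarrow> nat \<Rightarrow> real" where
  "central_moment M X k = (\<integral>\<omega>. (X \<omega> - (\<integral>\<omega>'. X \<omega>' \<partial>M)) ^ k \<partial>M)"

end

theory Submission imports Defs begin

text \<open>
  Put \<open>Y i = f (\<xi> i)\<close>, \<open>J = f ` I\<close> and \<open>\<Lambda> = L \<circ> the_inv_into I f\<close>. The \<open>Y i\<close> are independent, identically distributed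
  with values in the open interval \<open>J\<close>, and \<open>L\<close> of the quasi-arithmetic mean is \<open>\<Lambda>\<close> of the
  arithmetic mean \<open>m\<close> of \<open>Y 1, \<dots>, Y n\<close>. So everything is a statement about arithmetic means.

  Strong convexity means that at every point \<open>p\<close> the function \<open>\<Lambda>\<close> has a supporting line that it
  exceeds by at least \<open>(x - p)\<^sup>4\<close> (\<open>strongly_convex_support\<close>). Averaging this over several points
  gives a Jensen inequality with a remainder (\<open>strongly_convex_Jensen\<close>). It is applied to the \<open>n\<close>
  means \<open>P k\<close> obtained by leaving out \<open>Y k\<close>, whose average is \<open>m\<close>:
  \<open>\<Lambda> m + (1/n) \<Sum>k. (P k - m)\<^sup>4 \<le> (1/n) \<Sum>k. \<Lambda> (P k)\<close>.
  Every \<open>P k\<close> is distributed like the mean of \<open>Y 1, \<dots>, Y (n - 1)\<close>, so taking expectations leaves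
  only the fourth moment of \<open>P k - m\<close> to be computed. This variable is a linear combination of the
  \<open>Y i\<close> whose coefficients add up to \<open>0\<close>; since \<open>E S\<^sup>4 - 3 (E S\<^sup>2)\<^sup>2\<close>, the fourth cumulant, is
  additive over independent centred summands, the moment is the explicit term of the theorem
  (\<open>leave_one_out_deviation_moment\<close>).

  A supporting line also bounds \<open>\<Lambda> m\<close> from below by an affine function of \<open>m\<close>, which is integrable.
  Hence the expectations are in fact finite (\<open>integrable_strongly_convex_mean\<close>), and the extended
  expectations are ordinary integrals.
\<close>

section \<open>Strong convexity\<close>

text \<open>
  For \<open>x < p < y\<close> the weights that express \<open>p\<close> as a convex combination of \<open>x\<close> and \<open>y\<close> make the two
  arguments of \<open>\<alpha>\<close> in the definition equal to \<open>x - p\<close> and \<open>y - p\<close>. The definition then says that the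
  difference quotients at \<open>p\<close> of \<open>\<lambda>x. \<Lambda> x - \<alpha> (x - p)\<close> are not larger on the left of \<open>p\<close> than on
  the right, so any number between them, such as the supremum of those on the left, is the slope of a
  supporting line.
\<close>

lemma strongly_convex_support:
  assumes sc: "strongly_convex_wrt \<alpha> J \<Lambda>" and "open J" and p: "p \<in> J"
  obtains a where "\<And>x. x \<in> J \<Longrightarrow> \<Lambda> p + a * (x - p) + \<alpha> (x - p) \<le> \<Lambda> x"
proof -
  define s where "s = (\<lambda>x. (\<Lambda> x - \<alpha> (x - p) - \<Lambda> p) / (x - p))"
  have slope: "s x \<le> s y" if "x \<in> J" "y \<in> J" "x < p" "p < y" for x y
  proof -
    define t where "t = (y - p) / (y - x)"
    have t: "t \<in> {0..1}" "1 - t = (p - x) / (y - x)"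
      using that by (auto simp: t_def field_simps)
    have a: "(1 - t) * (x - y) = x - p" "t * (y - x) = y - p"
      using that unfolding t(2) by (auto simp: t_def field_simps)
    have b: "t * x + (1 - t) * y = p" using a by (simp add: algebra_simps)
    have "\<Lambda> p \<le> t * \<Lambda> x + (1 - t) * \<Lambda> y - t * \<alpha> (x - p) - (1 - t) * \<alpha> (y - p)"
      using sc that t(1) unfolding strongly_convex_wrt_def by (metis a b)
    also have "\<dots> = ((y - p) * (\<Lambda> x - \<alpha> (x - p)) + (p - x) * (\<Lambda> y - \<alpha> (y - p))) / (y - x)"
      unfolding t(2) by (simp add: t_def diff_divide_distrib add_divide_distrib right_diff_distrib
          left_diff_distrib)
    finally have "(y - x) * \<Lambda> p \<le> (y - p) * (\<Lambda> x - \<alpha> (x - p)) + (p - x) * (\<Lambda> y - \<alpha> (y - p))"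
      using that by (simp add: field_simps)
    then have "(y - p) * (\<Lambda> p - (\<Lambda> x - \<alpha> (x - p))) \<le> (p - x) * (\<Lambda> y - \<alpha> (y - p) - \<Lambda> p)"
      by (simp add: algebra_simps)
    then show ?thesis
      using that by (simp add: s_def divide_simps) (simp add: algebra_simps)
  qed
  obtain e where e: "e > 0" "ball p e \<subseteq> J"
    using \<open>open J\<close> p by (meson open_contains_ball)
  have nbr: "p - e / 2 \<in> J" "p + e / 2 \<in> J"
    using e by (auto simp: dist_real_def subset_iff)
  define a where "a = (SUP x\<in>{x \<in> J. x < p}. s x)"
  have bdd: "bdd_above (s ` {x \<in> J. x < p})"
    using slope[OF _ nbr(2)] e(1) by (auto intro!: bdd_aboveI[where M = "s (p + e / 2)"])
  have lo: "s x \<le> a" if "x \<in> J" "x < p" for x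
    unfolding a_def using that bdd by (intro cSUP_upper) auto
  have hi: "a \<le> s y" if "y \<in> J" "p < y" for y
    unfolding a_def using that nbr(1) e(1) slope by (intro cSUP_least) force+
  \<comment> \<open>At \<open>x = p\<close> the support inequality says \<open>\<alpha> 0 \<le> 0\<close>, which the definition yields for \<open>x = y = p\<close>.\<close>
  have zero: "\<alpha> 0 \<le> 0"
  proof -
    have "\<Lambda> (1 * p + (1 - 1) * p)
        \<le> 1 * \<Lambda> p + (1 - 1) * \<Lambda> p - 1 * \<alpha> ((1 - 1) * (p - p)) - (1 - 1) * \<alpha> (1 * (p - p))"
      using sc p unfolding strongly_convex_wrt_def
      by (meson atLeastAtMost_iff order_refl zero_le_one)
    then show ?thesis by simp
  qed
  show thesis
  proof (rule that[of a])
    fix x assume "x \<in> J"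
    consider "x < p" | "x = p" | "p < x" by linarith
    then show "\<Lambda> p + a * (x - p) + \<alpha> (x - p) \<le> \<Lambda> x"
    proof cases
      case 1
      with lo[OF \<open>x \<in> J\<close>] show ?thesis
        by (simp add: s_def divide_simps split: if_splits)
    next
      case 2
      with zero show ?thesis by simp
    next
      case 3
      with hi[OF \<open>x \<in> J\<close>] show ?thesis
        by (simp add: s_def divide_simps)
    qed
  qed
qed

text \<open>
  Average the support inequality at the weighted mean \<open>m\<close> over the points \<open>x i\<close>: the linear term
  vanishes.
\<close>

lemma strongly_convex_Jensen:
  assumes "strongly_convex_wrt \<alpha> J \<Lambda>" "open J" "convex J"
    and "finite A" "\<And>i. i \<in> A \<Longrightarrow> 0 \<le> w i" "sum w A = 1" "\<And>i. i \<in> A \<Longrightarrow> x i \<in> J"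
  defines "m \<equiv> \<Sum>i\<in>A. w i * x i"
  shows "\<Lambda> m + (\<Sum>i\<in>A. w i * \<alpha> (x i - m)) \<le> (\<Sum>i\<in>A. w i * \<Lambda> (x i))"
proof -
  have "m \<in> J"
    unfolding m_def using convex_sum[of A J w x] assms by simp
  then obtain a where a: "\<And>x. x \<in> J \<Longrightarrow> \<Lambda> m + a * (x - m) + \<alpha> (x - m) \<le> \<Lambda> x"
    using strongly_convex_support assms by blast
  have "(\<Sum>i\<in>A. w i * (x i - m)) = m - sum w A * m"
    by (simp add: right_diff_distrib sum_subtractf sum_distrib_right m_def)
  then have "(\<Sum>i\<in>A. w i * (\<Lambda> m)) + a * (\<Sum>i\<in>A. w i * (x i - m)) = \<Lambda> m"
    using \<open>sum w A = 1\<close> by (simp flip: sum_distrib_right)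
  then have "\<Lambda> m + (\<Sum>i\<in>A. w i * \<alpha> (x i - m))
      = (\<Sum>i\<in>A. w i * \<Lambda> m) + a * (\<Sum>i\<in>A. w i * (x i - m)) + (\<Sum>i\<in>A. w i * \<alpha> (x i - m))"
    by simp
  also have "\<dots> = (\<Sum>i\<in>A. w i * (\<Lambda> m + a * (x i - m) + \<alpha> (x i - m)))"
    by (simp add: distrib_left sum.distrib sum_distrib_left mult.left_commute)
  also have "\<dots> \<le> (\<Sum>i\<in>A. w i * \<Lambda> (x i))"
    using assms a by (intro sum_mono mult_left_mono) auto
  finally show ?thesis .
qed

lemma strongly_convex_imp_convex_on:
  assumes sc: "strongly_convex_wrt \<alpha> J \<Lambda>" and "convex J" and "\<And>x. 0 \<le> \<alpha> x"
  shows "convex_on J \<Lambda>"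
proof (rule convex_onI[OF _ \<open>convex J\<close>])
  fix t x y :: real
  assume *: "0 < t" "t < 1" "x \<in> J" "y \<in> J"
  have t: "1 - t \<in> {0..1}" using * by simp
  have "\<Lambda> ((1 - t) * x + (1 - (1 - t)) * y) \<le> (1 - t) * \<Lambda> x + (1 - (1 - t)) * \<Lambda> y
      - (1 - t) * \<alpha> ((1 - (1 - t)) * (x - y)) - (1 - (1 - t)) * \<alpha> ((1 - t) * (y - x))"
    using sc *(3,4) t unfolding strongly_convex_wrt_def by blast
  also have "\<dots> \<le> (1 - t) * \<Lambda> x + t * \<Lambda> y"
    using mult_nonneg_nonneg[OF _ assms(3)[of "t * (x - y)"], of "1 - t"]
      mult_nonneg_nonneg[OF _ assms(3)[of "(1 - t) * (y - x)"], of t] * by simp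
  finally show "\<Lambda> ((1 - t) *\<^sub>R x + t *\<^sub>R y) \<le> (1 - t) * \<Lambda> x + t * \<Lambda> y"
    by simp
qed

lemma leave_one_out_means:
  fixes x :: "'i \<Rightarrow> real"
  assumes "finite A" "2 \<le> card A"
  defines "n \<equiv> real (card A)"
  shows "(\<Sum>k\<in>A. 1 / n * ((\<Sum>i\<in>A - {k}. x i) / (n - 1))) = (\<Sum>i\<in>A. x i) / n"
proof -
  have n: "n \<ge> 2" using assms by simp
  have "(\<Sum>k\<in>A. 1 / n * ((\<Sum>i\<in>A - {k}. x i) / (n - 1)))
      = (\<Sum>k\<in>A. sum x A - x k) / (n * (n - 1))"
    using \<open>finite A\<close> by (simp add: sum_diff1 sum_divide_distrib)
  also have "\<dots> = sum x A * (n - 1) / (n * (n - 1))"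
    by (simp add: sum_subtractf n_def algebra_simps)
  also have "\<dots> = sum x A / n"
    using n by simp
  finally show ?thesis .
qed

section \<open>Fourth moments of sums of independent variables\<close>

lemma (in prob_space) integrable_power_le4:
  fixes U :: "'a \<Rightarrow> real"
  assumes [measurable]: "U \<in> borel_measurable M"
    and int: "integrable M (\<lambda>\<omega>. U \<omega> ^ 4)" and "k \<le> 4"
  shows "integrable M (\<lambda>\<omega>. U \<omega> ^ k)"
proof (rule Bochner_Integration.integrable_bound)
  show "integrable M (\<lambda>\<omega>. 1 + U \<omega> ^ 4)" using int by simp
  show "AE \<omega> in M. norm (U \<omega> ^ k) \<le> norm (1 + U \<omega> ^ 4)"
  proof (rule AE_I2)
    fix \<omega>
    have "\<bar>U \<omega>\<bar> ^ k \<le> 1 + \<bar>U \<omega>\<bar> ^ 4"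
    proof (cases "\<bar>U \<omega>\<bar> \<le> 1")
      case True
      then have "\<bar>U \<omega>\<bar> ^ k \<le> 1" by (simp add: power_le_one)
      then show ?thesis by (smt (verit) zero_le_power abs_ge_zero)
    next
      case False
      then have "\<bar>U \<omega>\<bar> ^ k \<le> \<bar>U \<omega>\<bar> ^ 4"
        using \<open>k \<le> 4\<close> by (intro power_increasing) auto
      then show ?thesis by simp
    qed
    then show "norm (U \<omega> ^ k) \<le> norm (1 + U \<omega> ^ 4)"
      by (simp add: power_abs)
  qed
qed simp

text \<open>
  In the binomial expansions every mixed term with a first power of \<open>U\<close> or \<open>V\<close> has expectation \<open>0\<close>.
\<close>

lemma (in prob_space) indep_centered_moments:
  fixes U V :: "'a \<Rightarrow> real"
  assumes indep: "indep_var borel U borel V"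
    and U4: "integrable M (\<lambda>\<omega>. U \<omega> ^ 4)" and V4: "integrable M (\<lambda>\<omega>. V \<omega> ^ 4)"
    and U1: "expectation U = 0" and V1: "expectation V = 0"
  shows "integrable M (\<lambda>\<omega>. (U \<omega> + V \<omega>) ^ 4)"
    and "expectation (\<lambda>\<omega>. (U \<omega> + V \<omega>) ^ 2)
      = expectation (\<lambda>\<omega>. U \<omega> ^ 2) + expectation (\<lambda>\<omega>. V \<omega> ^ 2)"
    and "expectation (\<lambda>\<omega>. (U \<omega> + V \<omega>) ^ 4)
      = expectation (\<lambda>\<omega>. U \<omega> ^ 4)
        + 6 * (expectation (\<lambda>\<omega>. U \<omega> ^ 2) * expectation (\<lambda>\<omega>. V \<omega> ^ 2))
        + expectation (\<lambda>\<omega>. V \<omega> ^ 4)"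
proof -
  have [measurable]: "U \<in> borel_measurable M" "V \<in> borel_measurable M"
    using indep_var_rv1[OF indep] indep_var_rv2[OF indep] by auto
  note Ui = integrable_power_le4[of U, OF _ U4] and Vi = integrable_power_le4[of V, OF _ V4]
  have ind: "indep_var borel (\<lambda>\<omega>. U \<omega> ^ a) borel (\<lambda>\<omega>. V \<omega> ^ b)" for a b
    using indep_var_compose[OF indep, of "\<lambda>x. x ^ a" borel "\<lambda>x. x ^ b" borel]
    by (simp add: comp_def)
  have int: "integrable M (\<lambda>\<omega>. U \<omega> ^ a * V \<omega> ^ b)" if "a \<le> 4" "b \<le> 4" for a b
    using that by (intro indep_var_integrable ind Ui Vi) auto
  have ex: "expectation (\<lambda>\<omega>. U \<omega> ^ a * V \<omega> ^ b)
      = expectation (\<lambda>\<omega>. U \<omega> ^ a) * expectation (\<lambda>\<omega>. V \<omega> ^ b)" if "a \<le> 4" "b \<le> 4" for a b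
    using that by (intro indep_var_lebesgue_integral ind Ui Vi) auto
  have binom4: "(U \<omega> + V \<omega>) ^ 4 = U \<omega> ^ 4 + (4 * (U \<omega> ^ 3 * V \<omega> ^ 1)
      + (6 * (U \<omega> ^ 2 * V \<omega> ^ 2) + (4 * (U \<omega> ^ 1 * V \<omega> ^ 3) + V \<omega> ^ 4)))" for \<omega>
    by (simp add: power4_eq_xxxx power3_eq_cube power2_eq_square algebra_simps)
  have binom2: "(U \<omega> + V \<omega>) ^ 2 = U \<omega> ^ 2 + (2 * (U \<omega> ^ 1 * V \<omega> ^ 1) + V \<omega> ^ 2)" for \<omega>
    by (simp add: power2_eq_square algebra_simps)
  show "integrable M (\<lambda>\<omega>. (U \<omega> + V \<omega>) ^ 4)"
    unfolding binom4
    by (intro Bochner_Integration.integrable_add integrable_mult_right int U4 V4) auto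
  have "expectation (\<lambda>\<omega>. (U \<omega> + V \<omega>) ^ 2) = expectation (\<lambda>\<omega>. U \<omega> ^ 2)
      + (2 * expectation (\<lambda>\<omega>. U \<omega> ^ 1 * V \<omega> ^ 1) + expectation (\<lambda>\<omega>. V \<omega> ^ 2))"
    unfolding binom2
    using int[of 1 1] Ui[of 2] Vi[of 2] by simp
  then show "expectation (\<lambda>\<omega>. (U \<omega> + V \<omega>) ^ 2)
      = expectation (\<lambda>\<omega>. U \<omega> ^ 2) + expectation (\<lambda>\<omega>. V \<omega> ^ 2)"
    using ex[of 1 1] U1 V1 by simp
  have "expectation (\<lambda>\<omega>. (U \<omega> + V \<omega>) ^ 4)
      = expectation (\<lambda>\<omega>. U \<omega> ^ 4) + (4 * expectation (\<lambda>\<omega>. U \<omega> ^ 3 * V \<omega> ^ 1)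
      + (6 * expectation (\<lambda>\<omega>. U \<omega> ^ 2 * V \<omega> ^ 2)
      + (4 * expectation (\<lambda>\<omega>. U \<omega> ^ 1 * V \<omega> ^ 3) + expectation (\<lambda>\<omega>. V \<omega> ^ 4))))"
    unfolding binom4
    using int[of 3 1] int[of 2 2] int[of 1 3] U4 V4 by simp
  then show "expectation (\<lambda>\<omega>. (U \<omega> + V \<omega>) ^ 4)
      = expectation (\<lambda>\<omega>. U \<omega> ^ 4)
        + 6 * (expectation (\<lambda>\<omega>. U \<omega> ^ 2) * expectation (\<lambda>\<omega>. V \<omega> ^ 2))
        + expectation (\<lambda>\<omega>. V \<omega> ^ 4)"
    using ex[of 3 1] ex[of 2 2] ex[of 1 3] U1 V1 by simp
qed

text \<open>
  The cross term \<open>6 E U\<^sup>2 E V\<^sup>2\<close> of the fourth moment of \<open>U + V\<close> is also the cross term of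
  \<open>3 (E U\<^sup>2 + E V\<^sup>2)\<^sup>2\<close>. The difference of the two is therefore additive, which replaces a sum
  over pairs of indices by a sum over indices.
\<close>

lemma (in prob_space) sum_indep_centered_moments:
  fixes X :: "'i \<Rightarrow> 'a \<Rightarrow> real"
  assumes "finite A" and "indep_vars (\<lambda>_. borel) X A"
    and "\<And>i. i \<in> A \<Longrightarrow> integrable M (\<lambda>\<omega>. X i \<omega> ^ 4)"
    and "\<And>i. i \<in> A \<Longrightarrow> expectation (X i) = 0"
  defines "S \<equiv> \<lambda>\<omega>. \<Sum>i\<in>A. X i \<omega>"
  shows "integrable M (\<lambda>\<omega>. S \<omega> ^ 4)"
    and "expectation (\<lambda>\<omega>. S \<omega> ^ 4) - 3 * (expectation (\<lambda>\<omega>. S \<omega> ^ 2))\<^sup>2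
      = (\<Sum>i\<in>A. expectation (\<lambda>\<omega>. X i \<omega> ^ 4) - 3 * (expectation (\<lambda>\<omega>. X i \<omega> ^ 2))\<^sup>2)"
    and "expectation (\<lambda>\<omega>. S \<omega> ^ 2) = (\<Sum>i\<in>A. expectation (\<lambda>\<omega>. X i \<omega> ^ 2))"
proof -
  \<comment> \<open>The induction also has to carry that the sum is centred.\<close>
  have "integrable M (\<lambda>\<omega>. (\<Sum>i\<in>A. X i \<omega>) ^ 4) \<and>
    expectation (\<lambda>\<omega>. \<Sum>i\<in>A. X i \<omega>) = 0 \<and>
    expectation (\<lambda>\<omega>. (\<Sum>i\<in>A. X i \<omega>) ^ 4) - 3 * (expectation (\<lambda>\<omega>. (\<Sum>i\<in>A. X i \<omega>) ^ 2))\<^sup>2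
      = (\<Sum>i\<in>A. expectation (\<lambda>\<omega>. X i \<omega> ^ 4) - 3 * (expectation (\<lambda>\<omega>. X i \<omega> ^ 2))\<^sup>2) \<and>
    expectation (\<lambda>\<omega>. (\<Sum>i\<in>A. X i \<omega>) ^ 2) = (\<Sum>i\<in>A. expectation (\<lambda>\<omega>. X i \<omega> ^ 2))"
    using assms(1-4)
  proof (induction A rule: finite_induct)
    case empty
    show ?case by simp
  next
    case (insert k A)
    define T where "T = (\<lambda>\<omega>. \<Sum>i\<in>A. X i \<omega>)"
    have IH: "integrable M (\<lambda>\<omega>. T \<omega> ^ 4)" "expectation T = 0"
      "expectation (\<lambda>\<omega>. T \<omega> ^ 4) - 3 * (expectation (\<lambda>\<omega>. T \<omega> ^ 2))\<^sup>2
        = (\<Sum>i\<in>A. expectation (\<lambda>\<omega>. X i \<omega> ^ 4) - 3 * (expectation (\<lambda>\<omega>. X i \<omega> ^ 2))\<^sup>2)"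
      "expectation (\<lambda>\<omega>. T \<omega> ^ 2) = (\<Sum>i\<in>A. expectation (\<lambda>\<omega>. X i \<omega> ^ 2))"
      using insert.IH insert.prems indep_vars_subset[OF insert.prems(1), of A]
      by (auto simp: T_def)
    have indep: "indep_var borel (X k) borel T"
      unfolding T_def using insert by (intro indep_vars_sum) auto
    have Xk: "integrable M (\<lambda>\<omega>. X k \<omega> ^ 4)" "expectation (X k) = 0"
      using insert.prems by auto
    have [measurable]: "X k \<in> borel_measurable M" "T \<in> borel_measurable M"
      using indep_var_rv1[OF indep] indep_var_rv2[OF indep] by auto
    have int1: "integrable M (X k)" "integrable M T"
      using integrable_power_le4[of "X k" 1] integrable_power_le4[of T 1] Xk IH by auto
    note add = indep_centered_moments[OF indep Xk(1) IH(1) Xk(2) IH(2)]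
    have E1: "expectation (\<lambda>\<omega>. X k \<omega> + T \<omega>) = 0"
      using int1 Xk IH by simp
    have sum: "(\<Sum>i\<in>insert k A. X i \<omega>) = X k \<omega> + T \<omega>" for \<omega>
      using insert by (simp add: T_def)
    have E4: "expectation (\<lambda>\<omega>. (X k \<omega> + T \<omega>) ^ 4)
        - 3 * (expectation (\<lambda>\<omega>. (X k \<omega> + T \<omega>) ^ 2))\<^sup>2
      = (expectation (\<lambda>\<omega>. X k \<omega> ^ 4) - 3 * (expectation (\<lambda>\<omega>. X k \<omega> ^ 2))\<^sup>2)
        + (expectation (\<lambda>\<omega>. T \<omega> ^ 4) - 3 * (expectation (\<lambda>\<omega>. T \<omega> ^ 2))\<^sup>2)"
      unfolding add(2,3) by (simp add: power2_eq_square algebra_simps)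
    show ?case
      unfolding sum using add(1) E1 E4 add(2) IH(3,4) insert.hyps by simp
  qed
  then show "integrable M (\<lambda>\<omega>. S \<omega> ^ 4)"
    and "expectation (\<lambda>\<omega>. S \<omega> ^ 4) - 3 * (expectation (\<lambda>\<omega>. S \<omega> ^ 2))\<^sup>2
      = (\<Sum>i\<in>A. expectation (\<lambda>\<omega>. X i \<omega> ^ 4) - 3 * (expectation (\<lambda>\<omega>. X i \<omega> ^ 2))\<^sup>2)"
    and "expectation (\<lambda>\<omega>. S \<omega> ^ 2) = (\<Sum>i\<in>A. expectation (\<lambda>\<omega>. X i \<omega> ^ 2))"
    unfolding S_def by blast+
qed

lemma (in prob_space) leave_one_out_deviation_moment:
  fixes X :: "'i \<Rightarrow> 'a \<Rightarrow> real"
  assumes fin: "finite A" "2 \<le> card A" and k: "k \<in> A"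
    and indep: "indep_vars (\<lambda>_. borel) X A"
    and int: "\<And>i. i \<in> A \<Longrightarrow> integrable M (\<lambda>\<omega>. X i \<omega> ^ 4)"
    and \<mu>: "\<And>i. i \<in> A \<Longrightarrow> expectation (X i) = \<mu>"
    and m2: "\<And>i. i \<in> A \<Longrightarrow> expectation (\<lambda>\<omega>. (X i \<omega> - \<mu>) ^ 2) = m2"
    and m4: "\<And>i. i \<in> A \<Longrightarrow> expectation (\<lambda>\<omega>. (X i \<omega> - \<mu>) ^ 4) = m4"
  defines "n \<equiv> real (card A)"
  defines "D \<equiv> \<lambda>\<omega>. (\<Sum>i\<in>A - {k}. X i \<omega>) / (n - 1) - (\<Sum>i\<in>A. X i \<omega>) / n"
  shows "integrable M (\<lambda>\<omega>. D \<omega> ^ 4)"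
    and "expectation (\<lambda>\<omega>. D \<omega> ^ 4)
      = 1 / ((n - 1) ^ 3 * n ^ 3) * ((n ^ 2 - 3 * n + 3) * m4 + 3 * (2 * n - 3) * m2 ^ 2)"
proof -
  have n: "n \<ge> 2" using fin by (simp add: n_def)
  \<comment> \<open>The coefficients of \<open>D\<close>; as they add up to \<open>0\<close>, \<open>D\<close> is unchanged when every \<open>X i\<close> is centred.\<close>
  define c where "c = (\<lambda>i. if i = k then - 1 / n else 1 / (n * (n - 1)))"
  define Z where "Z = (\<lambda>i \<omega>. c i * (X i \<omega> - \<mu>))"
  have sum_c: "(\<Sum>i\<in>A. g i * h (c i)) = g k * h (- 1 / n) + (\<Sum>i\<in>A - {k}. g i) * h (1 / (n * (n - 1)))"
    for g h :: "_ \<Rightarrow> real"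
  proof -
    have "(\<Sum>i\<in>A - {k}. g i * h (c i)) = (\<Sum>i\<in>A - {k}. g i * h (1 / (n * (n - 1))))"
      by (rule sum.cong) (auto simp: c_def)
    then show ?thesis
      using fin k by (simp add: sum.remove[of A k] c_def sum_distrib_right)
  qed
  have card: "(\<Sum>i\<in>A - {k}. 1::real) = n - 1"
    using fin k by (simp add: n_def of_nat_diff)
  have D: "D \<omega> = (\<Sum>i\<in>A. Z i \<omega>)" for \<omega>
  proof -
    have "(\<Sum>i\<in>A. Z i \<omega>) = (X k \<omega> - \<mu>) * (- 1 / n)
        + (\<Sum>i\<in>A - {k}. X i \<omega> - \<mu>) * (1 / (n * (n - 1)))"
      using sum_c[of "\<lambda>i. X i \<omega> - \<mu>" "\<lambda>x. x"] by (simp add: Z_def mult.commute)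
    also have "(\<Sum>i\<in>A - {k}. X i \<omega> - \<mu>) = (\<Sum>i\<in>A - {k}. X i \<omega>) - (n - 1) * \<mu>"
      unfolding card[symmetric] by (simp add: sum_subtractf)
    finally show ?thesis
      using n fin k by (simp add: D_def sum.remove[of A k] divide_simps) (simp add: algebra_simps)
  qed
  have Xm: "X i \<in> borel_measurable M" if "i \<in> A" for i
    using indep that by (auto simp: indep_vars_def)
  have Xi: "integrable M (X i)" if "i \<in> A" for i
    using integrable_power_le4[OF Xm int, of i 1] that by simp
  have X4: "integrable M (\<lambda>\<omega>. (X i \<omega> - \<mu>) ^ 4)" if "i \<in> A" for i
  proof -
    have ip: "integrable M (\<lambda>\<omega>. X i \<omega> ^ j)" if "j \<le> 4" for j
      using integrable_power_le4[OF Xm int, of i j] that \<open>i \<in> A\<close> by simp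
    have "(X i \<omega> - \<mu>) ^ 4 = X i \<omega> ^ 4 - 4 * \<mu> * X i \<omega> ^ 3 + 6 * \<mu>\<^sup>2 * X i \<omega> ^ 2
        - 4 * \<mu> ^ 3 * X i \<omega> + \<mu> ^ 4" for \<omega>
      by (simp add: power4_eq_xxxx power3_eq_cube power2_eq_square algebra_simps)
    then show ?thesis
      using ip[of 2] ip[of 3] ip[of 4] Xi[OF \<open>i \<in> A\<close>] by simp
  qed
  have Z_indep: "indep_vars (\<lambda>_. borel) Z A"
    unfolding Z_def by (rule indep_vars_compose2[OF indep]) simp
  have Z4: "integrable M (\<lambda>\<omega>. Z i \<omega> ^ 4)" if "i \<in> A" for i
    using X4[OF that] by (simp add: Z_def power_mult_distrib)
  have Z1: "expectation (Z i) = 0" if "i \<in> A" for i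
    using Xi[OF that] \<mu>[OF that] by (simp add: Z_def prob_space)
  have moments: "integrable M (\<lambda>\<omega>. D \<omega> ^ 4)"
    "expectation (\<lambda>\<omega>. D \<omega> ^ 4) - 3 * (expectation (\<lambda>\<omega>. D \<omega> ^ 2))\<^sup>2
      = (\<Sum>i\<in>A. expectation (\<lambda>\<omega>. Z i \<omega> ^ 4) - 3 * (expectation (\<lambda>\<omega>. Z i \<omega> ^ 2))\<^sup>2)"
    "expectation (\<lambda>\<omega>. D \<omega> ^ 2) = (\<Sum>i\<in>A. expectation (\<lambda>\<omega>. Z i \<omega> ^ 2))"
    unfolding D by (rule sum_indep_centered_moments[OF fin(1) Z_indep Z4 Z1]; assumption)+
  show "integrable M (\<lambda>\<omega>. D \<omega> ^ 4)" by (rule moments(1))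
  have E2: "expectation (\<lambda>\<omega>. Z i \<omega> ^ 2) = m2 * c i ^ 2"
    and E4: "expectation (\<lambda>\<omega>. Z i \<omega> ^ 4) = m4 * c i ^ 4" if "i \<in> A" for i
    using m2[OF that] m4[OF that] by (simp_all add: Z_def power_mult_distrib)
  have D2: "expectation (\<lambda>\<omega>. D \<omega> ^ 2) = m2 * ((- 1 / n)\<^sup>2 + (n - 1) * (1 / (n * (n - 1)))\<^sup>2)"
    using sum_c[of "\<lambda>_. 1" "\<lambda>x. m2 * x ^ 2"] unfolding card
    by (simp add: moments(3) E2 distrib_left mult.left_commute)
  have "(\<Sum>i\<in>A. expectation (\<lambda>\<omega>. Z i \<omega> ^ 4) - 3 * (expectation (\<lambda>\<omega>. Z i \<omega> ^ 2))\<^sup>2)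
      = (\<Sum>i\<in>A. 1 * ((m4 - 3 * m2\<^sup>2) * c i ^ 4))"
    by (rule sum.cong) (auto simp: E2 E4 power_mult_distrib algebra_simps simp flip: power_mult)
  also have "\<dots> = (m4 - 3 * m2\<^sup>2) * ((- 1 / n) ^ 4 + (n - 1) * (1 / (n * (n - 1))) ^ 4)"
    unfolding sum_c[of "\<lambda>_. 1" "\<lambda>x. (m4 - 3 * m2\<^sup>2) * x ^ 4"] card by (simp add: algebra_simps)
  finally have "expectation (\<lambda>\<omega>. D \<omega> ^ 4)
      = (m4 - 3 * m2\<^sup>2) * ((- 1 / n) ^ 4 + (n - 1) * (1 / (n * (n - 1))) ^ 4)
        + 3 * (m2 * ((- 1 / n)\<^sup>2 + (n - 1) * (1 / (n * (n - 1)))\<^sup>2))\<^sup>2"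
    using moments(2) unfolding D2 by simp
  also have "\<dots> = 1 / ((n - 1) ^ 3 * n ^ 3)
      * ((n ^ 2 - 3 * n + 3) * m4 + 3 * (2 * n - 3) * m2 ^ 2)"
  proof -
    have "(- 1 / n)\<^sup>2 + (n - 1) * (1 / (n * (n - 1)))\<^sup>2 = 1 / (n * (n - 1))"
      using n by (simp add: divide_simps) (simp add: power2_eq_square algebra_simps)
    moreover have "(- 1 / n) ^ 4 + (n - 1) * (1 / (n * (n - 1))) ^ 4
        = (n\<^sup>2 - 3 * n + 3) / (n ^ 3 * (n - 1) ^ 3)"
      using n by (simp add: divide_simps)
        (simp add: power4_eq_xxxx power3_eq_cube power2_eq_square algebra_simps)
    moreover have "n - 1 \<noteq> 0" "n \<noteq> 0" using n by auto
    ultimately show ?thesis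
      by (simp add: divide_simps) (simp add: power4_eq_xxxx power3_eq_cube power2_eq_square algebra_simps)
  qed
  finally show "expectation (\<lambda>\<omega>. D \<omega> ^ 4)
      = 1 / ((n - 1) ^ 3 * n ^ 3) * ((n ^ 2 - 3 * n + 3) * m4 + 3 * (2 * n - 3) * m2 ^ 2)" .
qed

section \<open>Sample means\<close>

text \<open>
  The characteristic function of the sum is the power of the common characteristic function whose
  exponent is the number of summands, and it determines the distribution.
\<close>

lemma (in prob_space) distr_sum_iid_cong_card:
  fixes X :: "'i \<Rightarrow> 'a \<Rightarrow> real"
  assumes "indep_vars (\<lambda>_. borel) X A" "indep_vars (\<lambda>_. borel) X B"
    and "\<And>i. i \<in> A \<union> B \<Longrightarrow> distr M borel (X i) = \<nu>" and "card A = card B"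
  shows "distr M borel (\<lambda>\<omega>. \<Sum>i\<in>A. X i \<omega>) = distr M borel (\<lambda>\<omega>. \<Sum>i\<in>B. X i \<omega>)"
proof (rule Levy_uniqueness)
  have "X i \<in> borel_measurable M" if "i \<in> A \<union> B" for i
    using assms(1,2) that by (auto simp: indep_vars_def)
  then show "real_distribution (distr M borel (\<lambda>\<omega>. \<Sum>i\<in>A. X i \<omega>))"
    "real_distribution (distr M borel (\<lambda>\<omega>. \<Sum>i\<in>B. X i \<omega>))"
    by (auto intro!: real_distribution_distr)
  show "char (distr M borel (\<lambda>\<omega>. \<Sum>i\<in>A. X i \<omega>)) = char (distr M borel (\<lambda>\<omega>. \<Sum>i\<in>B. X i \<omega>))"
    using assms by (simp add: char_distr_sum fun_eq_iff)
qed

lemma convex_mean_in: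
  fixes x :: "'i \<Rightarrow> real"
  assumes "convex J" "finite A" "A \<noteq> {}" "\<And>i. i \<in> A \<Longrightarrow> x i \<in> J"
  shows "(\<Sum>i\<in>A. x i) / card A \<in> J"
  using convex_sum[of A J "\<lambda>_. 1 / card A" x] assms by (simp add: sum_divide_distrib)

text \<open>
  A supporting line bounds \<open>\<Lambda>\<close> of the mean from below by an integrable variable, and Jensen's
  inequality bounds it from above by the mean of the \<open>\<Lambda> (X i)\<close>.
\<close>

lemma (in prob_space) integrable_strongly_convex_mean:
  fixes X :: "'i \<Rightarrow> 'a \<Rightarrow> real"
  assumes J: "open J" "convex J" and sc: "strongly_convex_wrt \<alpha> J \<Lambda>" and \<alpha>: "\<And>x. 0 \<le> \<alpha> x"
    and A: "finite A" "A \<noteq> {}"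
    and XJ: "\<And>i \<omega>. i \<in> A \<Longrightarrow> \<omega> \<in> space M \<Longrightarrow> X i \<omega> \<in> J"
    and Xi: "\<And>i. i \<in> A \<Longrightarrow> integrable M (X i)"
    and \<Lambda>i: "\<And>i. i \<in> A \<Longrightarrow> integrable M (\<lambda>\<omega>. \<Lambda> (X i \<omega>))"
  shows "integrable M (\<lambda>\<omega>. \<Lambda> ((\<Sum>i\<in>A. X i \<omega>) / card A))"
proof -
  define m where "m = (\<lambda>\<omega>. (\<Sum>i\<in>A. X i \<omega>) / card A)"
  have mJ: "m \<omega> \<in> J" if "\<omega> \<in> space M" for \<omega>
    unfolding m_def using J A XJ that by (intro convex_mean_in) auto
  have mi: "integrable M m"
    unfolding m_def using Xi by simp
  \<comment> \<open>Any point of \<open>J\<close> can carry the supporting line; a value of \<open>m\<close> is one at hand.\<close>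
  obtain \<omega>0 where "\<omega>0 \<in> space M" using not_empty by blast
  then obtain a where a: "\<And>x. x \<in> J \<Longrightarrow>
      \<Lambda> (m \<omega>0) + a * (x - m \<omega>0) + \<alpha> (x - m \<omega>0) \<le> \<Lambda> x"
    using strongly_convex_support[OF sc J(1) mJ] by blast
  define lo where "lo = (\<lambda>\<omega>. \<Lambda> (m \<omega>0) + a * (m \<omega> - m \<omega>0))"
  define hi where "hi = (\<lambda>\<omega>. \<Sum>i\<in>A. 1 / card A * \<Lambda> (X i \<omega>))"
  have meas: "(\<lambda>\<omega>. \<Lambda> (m \<omega>)) \<in> borel_measurable M"
    using convex_measurable[of m M J \<Lambda>] strongly_convex_imp_convex_on[OF sc J(2) \<alpha>] J mJ
      borel_measurable_integrable[OF mi]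
    by (auto simp: comp_def)
  have bound_int: "integrable M (\<lambda>\<omega>. \<bar>lo \<omega>\<bar> + \<bar>hi \<omega>\<bar>)"
    unfolding lo_def hi_def using mi \<Lambda>i by simp
  have "norm (\<Lambda> (m \<omega>)) \<le> norm (\<bar>lo \<omega>\<bar> + \<bar>hi \<omega>\<bar>)" if "\<omega> \<in> space M" for \<omega>
  proof -
    have "lo \<omega> \<le> \<Lambda> (m \<omega>)"
      using a[OF mJ[OF that]] \<alpha>[of "m \<omega> - m \<omega>0"] by (simp add: lo_def)
    moreover have "\<Lambda> (m \<omega>) \<le> hi \<omega>"
    proof -
      have "m \<omega> = (\<Sum>i\<in>A. 1 / card A * X i \<omega>)"
        by (simp add: m_def sum_divide_distrib)
      moreover have "0 \<le> (\<Sum>i\<in>A. 1 / card A * \<alpha> (X i \<omega> - (\<Sum>i\<in>A. 1 / card A * X i \<omega>)))"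
        using \<alpha> by (intro sum_nonneg) auto
      ultimately show ?thesis
        using strongly_convex_Jensen[OF sc J A(1), of "\<lambda>_. 1 / card A" "\<lambda>i. X i \<omega>"] A XJ that
        by (simp add: hi_def)
    qed
    ultimately show ?thesis by simp
  qed
  then have "integrable M (\<lambda>\<omega>. \<Lambda> (m \<omega>))"
    by (intro Bochner_Integration.integrable_bound[OF bound_int meas] AE_I2)
  then show ?thesis
    unfolding m_def .
qed

lemma (in prob_space) expectation_cong_distr:
  fixes U V h :: "_ \<Rightarrow> real"
  assumes "U \<in> borel_measurable M" "V \<in> borel_measurable M" "h \<in> borel_measurable borel"
    and "distr M borel U = distr M borel V"
  shows "expectation (\<lambda>\<omega>. h (U \<omega>)) = expectation (\<lambda>\<omega>. h (V \<omega>))"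
    and "integrable M (\<lambda>\<omega>. h (U \<omega>)) \<longleftrightarrow> integrable M (\<lambda>\<omega>. h (V \<omega>))"
  using assms by (simp_all flip: integral_distr integrable_distr_eq)

text \<open>
  A convex function on \<open>J\<close> is continuous on the open set \<open>J\<close>, but nothing is known about its values
  elsewhere, so it need not be a Borel function on the whole line.
\<close>

lemma (in prob_space) expectation_cong_distr_on:
  fixes U V h :: "_ \<Rightarrow> real"
  assumes "U \<in> borel_measurable M" "V \<in> borel_measurable M"
    and J: "open J" "continuous_on J h"
    and UJ: "\<And>\<omega>. \<omega> \<in> space M \<Longrightarrow> U \<omega> \<in> J" and VJ: "\<And>\<omega>. \<omega> \<in> space M \<Longrightarrow> V \<omega> \<in> J"
    and "distr M borel U = distr M borel V"
  shows "expectation (\<lambda>\<omega>. h (U \<omega>)) = expectation (\<lambda>\<omega>. h (V \<omega>))"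
    and "integrable M (\<lambda>\<omega>. h (U \<omega>)) \<longleftrightarrow> integrable M (\<lambda>\<omega>. h (V \<omega>))"
proof -
  define g where "g = (\<lambda>x. if x \<in> J then h x else 0)"
  have g: "g \<in> borel_measurable borel"
    unfolding g_def using J by (intro borel_measurable_continuous_on_if) auto
  have "expectation (\<lambda>\<omega>. h (U \<omega>)) = expectation (\<lambda>\<omega>. g (U \<omega>))"
    "expectation (\<lambda>\<omega>. h (V \<omega>)) = expectation (\<lambda>\<omega>. g (V \<omega>))"
    "integrable M (\<lambda>\<omega>. h (U \<omega>)) \<longleftrightarrow> integrable M (\<lambda>\<omega>. g (U \<omega>))"
    "integrable M (\<lambda>\<omega>. h (V \<omega>)) \<longleftrightarrow> integrable M (\<lambda>\<omega>. g (V \<omega>))"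
    using UJ VJ by (auto simp: g_def cong: Bochner_Integration.integral_cong Bochner_Integration.integrable_cong)
  then show "expectation (\<lambda>\<omega>. h (U \<omega>)) = expectation (\<lambda>\<omega>. h (V \<omega>))"
    and "integrable M (\<lambda>\<omega>. h (U \<omega>)) \<longleftrightarrow> integrable M (\<lambda>\<omega>. h (V \<omega>))"
    using expectation_cong_distr[OF assms(1,2) g assms(7)] by auto
qed

text \<open>
  Integrate the Jensen inequality for the leave-one-out means \<open>P k\<close>. Independence and identical
  distribution make the expectations of \<open>\<Lambda> (P k)\<close> and of \<open>(P k - m)\<^sup>4\<close> the same for all \<open>k\<close>.
\<close>

lemma (in prob_space) expectation_mean_decrease:
  fixes X :: "'i \<Rightarrow> 'a \<Rightarrow> real"
  assumes J: "open J" "convex J" and sc: "strongly_convex_wrt (\<lambda>x. x ^ 4) J \<Lambda>"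
    and A: "finite A" "2 \<le> card A" and B: "B \<subseteq> A" "card B = card A - 1"
    and indep: "indep_vars (\<lambda>_. borel) X A"
    and \<nu>: "\<And>i. i \<in> A \<Longrightarrow> distr M borel (X i) = \<nu>"
    and XJ: "\<And>i \<omega>. i \<in> A \<Longrightarrow> \<omega> \<in> space M \<Longrightarrow> X i \<omega> \<in> J"
    and j: "j \<in> A" and X4: "integrable M (\<lambda>\<omega>. X j \<omega> ^ 4)"
    and \<Lambda>X: "integrable M (\<lambda>\<omega>. \<Lambda> (X j \<omega>))"
  defines "n \<equiv> real (card A)"
  shows "integrable M (\<lambda>\<omega>. \<Lambda> ((\<Sum>i\<in>A. X i \<omega>) / n))"
    and "integrable M (\<lambda>\<omega>. \<Lambda> ((\<Sum>i\<in>B. X i \<omega>) / (n - 1)))"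
    and "expectation (\<lambda>\<omega>. \<Lambda> ((\<Sum>i\<in>A. X i \<omega>) / n))
      \<le> expectation (\<lambda>\<omega>. \<Lambda> ((\<Sum>i\<in>B. X i \<omega>) / (n - 1)))
        - 1 / ((n - 1) ^ 3 * n ^ 3) * ((n ^ 2 - 3 * n + 3) * central_moment M (X j) 4
            + 3 * (2 * n - 3) * (central_moment M (X j) 2) ^ 2)"
proof -
  have n: "n \<ge> 2" using A by (simp add: n_def)
  have Xm: "X i \<in> borel_measurable M" if "i \<in> A" for i
    using indep that by (auto simp: indep_vars_def)
  have cont: "continuous_on J \<Lambda>"
    using J strongly_convex_imp_convex_on[OF sc J(2)] by (intro convex_on_continuous) auto
  have same: "distr M borel (X i) = distr M borel (X j)" if "i \<in> A" for i
    using \<nu> that j by simp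
  note cong = expectation_cong_distr[OF Xm Xm[OF j] _ same]
  have X4': "integrable M (\<lambda>\<omega>. X i \<omega> ^ 4)" if "i \<in> A" for i
    using X4 cong(2)[of i "\<lambda>x. x ^ 4"] that by simp
  have X1: "integrable M (X i)" if "i \<in> A" for i
    using integrable_power_le4[OF Xm X4', of i 1] that by simp
  have \<Lambda>X': "integrable M (\<lambda>\<omega>. \<Lambda> (X i \<omega>))" if "i \<in> A" for i
    using \<Lambda>X expectation_cong_distr_on(2)[OF Xm Xm[OF j] J(1) cont XJ XJ[OF j] same] that by blast
  have mean_int: "integrable M (\<lambda>\<omega>. \<Lambda> ((\<Sum>i\<in>C. X i \<omega>) / card C))"
    if "C \<subseteq> A" "C \<noteq> {}" for C
    using that A XJ X1 \<Lambda>X'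
    by (intro integrable_strongly_convex_mean[OF J sc]) (auto intro: finite_subset)
  have card_n: "real (card C) = n - 1" "C \<noteq> {}" if "card C = card A - 1" for C :: "'i set"
    using that A by (auto simp: n_def of_nat_diff)
  show int_A: "integrable M (\<lambda>\<omega>. \<Lambda> ((\<Sum>i\<in>A. X i \<omega>) / n))"
    using mean_int[of A] j by (auto simp: n_def)
  show "integrable M (\<lambda>\<omega>. \<Lambda> ((\<Sum>i\<in>B. X i \<omega>) / (n - 1)))"
    using mean_int[of B] B card_n[of B] by simp
  define P where "P = (\<lambda>k \<omega>. (\<Sum>i\<in>A - {k}. X i \<omega>) / (n - 1))"
  define m where "m = (\<lambda>\<omega>. (\<Sum>i\<in>A. X i \<omega>) / n)"
  define q where "q = 1 / ((n - 1) ^ 3 * n ^ 3) * ((n ^ 2 - 3 * n + 3) * central_moment M (X j) 4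
            + 3 * (2 * n - 3) * (central_moment M (X j) 2) ^ 2)"
  have P_in: "(\<Sum>i\<in>C. X i \<omega>) / (n - 1) \<in> J" if "C \<subseteq> A" "card C = card A - 1" "\<omega> \<in> space M" for C \<omega>
    using convex_mean_in[OF J(2), of C "\<lambda>i. X i \<omega>"] card_n[of C] that A XJ
    by (auto intro: finite_subset)
  have int_P: "integrable M (\<lambda>\<omega>. \<Lambda> (P k \<omega>))"
    and E_P: "expectation (\<lambda>\<omega>. \<Lambda> (P k \<omega>)) = expectation (\<lambda>\<omega>. \<Lambda> ((\<Sum>i\<in>B. X i \<omega>) / (n - 1)))"
    if k: "k \<in> A" for k
  proof -
    have C: "A - {k} \<subseteq> A" "card (A - {k}) = card A - 1" using A k by auto
    show "integrable M (\<lambda>\<omega>. \<Lambda> (P k \<omega>))"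
      using mean_int[of "A - {k}"] card_n[OF C(2)] by (simp add: P_def)
    have d: "distr M borel (\<lambda>\<omega>. \<Sum>i\<in>A - {k}. X i \<omega>) = distr M borel (\<lambda>\<omega>. \<Sum>i\<in>B. X i \<omega>)"
      using C B \<nu> by (intro distr_sum_iid_cong_card indep_vars_subset[OF indep]) auto
    have [measurable]: "(\<lambda>\<omega>. \<Sum>i\<in>A - {k}. X i \<omega>) \<in> borel_measurable M"
      "(\<lambda>\<omega>. \<Sum>i\<in>B. X i \<omega>) \<in> borel_measurable M"
      using Xm B by (auto intro!: borel_measurable_sum)
    have "distr (distr M borel (\<lambda>\<omega>. \<Sum>i\<in>A - {k}. X i \<omega>)) borel (\<lambda>x. x / (n - 1))
        = distr (distr M borel (\<lambda>\<omega>. \<Sum>i\<in>B. X i \<omega>)) borel (\<lambda>x. x / (n - 1))"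
      unfolding d ..
    then have "distr M borel (P k) = distr M borel (\<lambda>\<omega>. (\<Sum>i\<in>B. X i \<omega>) / (n - 1))"
      by (simp add: distr_distr comp_def P_def)
    then show "expectation (\<lambda>\<omega>. \<Lambda> (P k \<omega>)) = expectation (\<lambda>\<omega>. \<Lambda> ((\<Sum>i\<in>B. X i \<omega>) / (n - 1)))"
      using P_in[OF C] P_in[OF B]
      by (intro expectation_cong_distr_on(1)[OF _ _ J(1) cont]) (auto simp: P_def)
  qed
  have D: "integrable M (\<lambda>\<omega>. (P k \<omega> - m \<omega>) ^ 4)" "expectation (\<lambda>\<omega>. (P k \<omega> - m \<omega>) ^ 4) = q"
    if k: "k \<in> A" for k
  proof -
    have \<mu>: "expectation (X i) = expectation (X j)" if "i \<in> A" for i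
      using cong(1)[of i "\<lambda>x. x"] that by simp
    have mom: "expectation (\<lambda>\<omega>. (X i \<omega> - expectation (X j)) ^ r) = central_moment M (X j) r"
      if "i \<in> A" for i r
      using cong(1)[of i "\<lambda>x. (x - expectation (X j)) ^ r"] that by (simp add: central_moment_def)
    show "integrable M (\<lambda>\<omega>. (P k \<omega> - m \<omega>) ^ 4)" "expectation (\<lambda>\<omega>. (P k \<omega> - m \<omega>) ^ 4) = q"
      unfolding P_def m_def q_def n_def
      by (rule leave_one_out_deviation_moment[OF A k indep X4' \<mu> mom mom]; assumption)+
  qed
  have int_m: "integrable M (\<lambda>\<omega>. \<Lambda> (m \<omega>))"
    using int_A unfolding m_def .
  have "expectation (\<lambda>\<omega>. \<Lambda> (m \<omega>)) + q
      = expectation (\<lambda>\<omega>. \<Lambda> (m \<omega>) + (\<Sum>k\<in>A. 1 / n * (P k \<omega> - m \<omega>) ^ 4))"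
  proof -
    have "(\<Sum>k\<in>A. 1 / n * q) = q" using n by (simp add: n_def)
    moreover have "expectation (\<lambda>\<omega>. \<Sum>k\<in>A. 1 / n * (P k \<omega> - m \<omega>) ^ 4) = (\<Sum>k\<in>A. 1 / n * q)"
      using D by (subst Bochner_Integration.integral_sum) auto
    moreover have "integrable M (\<lambda>\<omega>. \<Sum>k\<in>A. 1 / n * (P k \<omega> - m \<omega>) ^ 4)"
      using D(1) by (intro Bochner_Integration.integrable_sum integrable_mult_right)
    ultimately show ?thesis
      by (simp only: Bochner_Integration.integral_add[OF int_m])
  qed
  also have "\<dots> \<le> expectation (\<lambda>\<omega>. \<Sum>k\<in>A. 1 / n * \<Lambda> (P k \<omega>))"
  proof (rule integral_mono)
    show "integrable M (\<lambda>\<omega>. \<Lambda> (m \<omega>) + (\<Sum>k\<in>A. 1 / n * (P k \<omega> - m \<omega>) ^ 4))"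
      using D(1) by (intro Bochner_Integration.integrable_add Bochner_Integration.integrable_sum
          integrable_mult_right int_m)
    show "integrable M (\<lambda>\<omega>. \<Sum>k\<in>A. 1 / n * \<Lambda> (P k \<omega>))"
      using int_P by (intro Bochner_Integration.integrable_sum integrable_mult_right)
    fix \<omega> assume \<omega>: "\<omega> \<in> space M"
    have "(\<Sum>k\<in>A. 1 / n * P k \<omega>) = m \<omega>"
      using leave_one_out_means[OF A, of "\<lambda>i. X i \<omega>"] by (simp add: P_def m_def n_def)
    moreover have "P k \<omega> \<in> J" if "k \<in> A" for k
      unfolding P_def using A that \<omega> by (intro P_in) auto
    moreover have "sum (\<lambda>_. 1 / n) A = 1" using n by (simp add: n_def)
    ultimately show "\<Lambda> (m \<omega>) + (\<Sum>k\<in>A. 1 / n * (P k \<omega> - m \<omega>) ^ 4) \<le> (\<Sum>k\<in>A. 1 / n * \<Lambda> (P k \<omega>))"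
      using strongly_convex_Jensen[OF sc J A(1), of "\<lambda>_. 1 / n" "\<lambda>k. P k \<omega>"] n by simp
  qed
  also have "\<dots> = (\<Sum>k\<in>A. 1 / n * expectation (\<lambda>\<omega>. \<Lambda> (P k \<omega>)))"
    using int_P by (simp add: Bochner_Integration.integral_sum)
  also have "\<dots> = expectation (\<lambda>\<omega>. \<Lambda> ((\<Sum>i\<in>B. X i \<omega>) / (n - 1)))"
    using E_P n by (simp add: n_def)
  finally show "expectation (\<lambda>\<omega>. \<Lambda> ((\<Sum>i\<in>A. X i \<omega>) / n))
      \<le> expectation (\<lambda>\<omega>. \<Lambda> ((\<Sum>i\<in>B. X i \<omega>) / (n - 1)))
        - 1 / ((n - 1) ^ 3 * n ^ 3) * ((n ^ 2 - 3 * n + 3) * central_moment M (X j) 4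
            + 3 * (2 * n - 3) * (central_moment M (X j) 2) ^ 2)"
    unfolding m_def q_def by simp
qed

section \<open>Quasi-arithmetic means\<close>

lemma ext_expectation_eq_integral:
  assumes "integrable M X"
  shows "ext_expectation M X = ereal (\<integral>\<omega>. X \<omega> \<partial>M)"
proof -
  obtain r q where "0 \<le> r" "0 \<le> q" "(\<integral>\<^sup>+\<omega>. ennreal (X \<omega>) \<partial>M) = ennreal r"
    "(\<integral>\<^sup>+\<omega>. ennreal (- X \<omega>) \<partial>M) = ennreal q" "integral\<^sup>L M X = r - q"
    using assms by (rule integrableE)
  then show ?thesis
    by (simp add: ext_expectation_def enn2ereal_ennreal)
qed

theorem corollary5p6:
  fixes M :: "'a measure"
    and I :: "real set"
    and f L :: "real \<Rightarrow> real"
    and \<xi> :: "nat \<Rightarrow> 'a \<Rightarrow> real"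
  assumes "prob_space M"
    and "is_interval I" and "open I" and "I \<noteq> {}"
    and "continuous_on I f" and "strict_mono_on I f"
    and "prob_space.indep_vars M (\<lambda>_. borel) \<xi> {1..}"
    and "\<And>n. n \<ge> 1 \<Longrightarrow> distr M borel (\<xi> n) = distr M borel (\<xi> 1)"
    and "\<And>n \<omega>. n \<ge> 1 \<Longrightarrow> \<omega> \<in> space M \<Longrightarrow> \<xi> n \<omega> \<in> I"
    and "integrable M (\<lambda>\<omega>. (f (\<xi> 1 \<omega>)) ^ 4)"
    and "strongly_convex_wrt (\<lambda>x. x ^ 4) (f ` I) (L \<circ> the_inv_into I f)"
    and "integrable M (\<lambda>\<omega>. \<bar>L (\<xi> 1 \<omega>)\<bar>)"
  shows "(\<forall>n\<ge>2. expectation_below_top M (\<lambda>\<omega>. L (quasi_arith_mean I f n (\<lambda>i. \<xi> i \<omega>)))) \<and>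
    (\<forall>n\<ge>2.
       ext_expectation M (\<lambda>\<omega>. L (quasi_arith_mean I f n (\<lambda>i. \<xi> i \<omega>)))
       \<le> ext_expectation M (\<lambda>\<omega>. L (quasi_arith_mean I f (n - 1) (\<lambda>i. \<xi> i \<omega>)))
          - ereal (1 / ((real n - 1) ^ 3 * real n ^ 3)
              * ((real n ^ 2 - 3 * real n + 3) * central_moment M (\<lambda>\<omega>. f (\<xi> 1 \<omega>)) 4
                 + 3 * (2 * real n - 3) * (central_moment M (\<lambda>\<omega>. f (\<xi> 1 \<omega>)) 2) ^ 2)))"
proof -
  interpret prob_space M by fact
  define J where "J = f ` I"
  define \<Lambda> where "\<Lambda> = L \<circ> the_inv_into I f"
  have inj: "inj_on f I"
    using \<open>strict_mono_on I f\<close> by (rule strict_mono_on_imp_inj_on)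
  have J: "open J" "convex J"
  proof -
    show "open J"
      unfolding J_def using assms(3,5) inj
      by (intro injective_into_1d_imp_open_map_UNIV[of I I]) auto
    have "connected J"
      unfolding J_def using assms(2,5) is_interval_connected_1
      by (intro connected_continuous_image) auto
    then show "convex J"
      by (simp add: is_interval_connected_1 flip: is_interval_convex_1)
  qed
  have sc: "strongly_convex_wrt (\<lambda>x. x ^ 4) J \<Lambda>"
    using assms(11) by (simp add: J_def \<Lambda>_def)
  have \<Lambda>f: "\<Lambda> (f x) = L x" if "x \<in> I" for x
    using inj that by (simp add: \<Lambda>_def the_inv_into_f_f)
  \<comment> \<open>\<open>f\<close> may fail to be measurable outside \<open>I\<close>, so it is replaced there by \<open>0\<close>.\<close>
  define g where "g = (\<lambda>x. if x \<in> I then f x else 0)"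
  have g: "g \<in> borel_measurable borel"
    unfolding g_def using assms(3,5) by (intro borel_measurable_continuous_on_if) auto
  define Y where "Y = (\<lambda>i \<omega>. g (\<xi> i \<omega>))"
  have Yf: "Y i \<omega> = f (\<xi> i \<omega>)" if "i \<ge> 1" "\<omega> \<in> space M" for i \<omega>
    using assms(9)[OF that] by (simp add: Y_def g_def)
  have Y_indep: "indep_vars (\<lambda>_. borel) Y {1..}"
    unfolding Y_def using g by (intro indep_vars_compose2[OF assms(7)]) auto
  have Y_distr: "distr M borel (Y i) = distr M borel (Y 1)" if "i \<ge> 1" for i
  proof -
    have *: "distr M borel (Y i) = distr (distr M borel (\<xi> i)) borel g" if "i \<ge> 1" for i
      using assms(7) that g by (subst distr_distr) (auto simp: indep_vars_def Y_def comp_def)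
    show ?thesis using *[OF that] *[of 1] assms(8)[OF that] by simp
  qed
  have YJ: "Y i \<omega> \<in> J" if "i \<ge> 1" "\<omega> \<in> space M" for i \<omega>
    using Yf[OF that] assms(9)[OF that] by (simp add: J_def)
  have Y4: "integrable M (\<lambda>\<omega>. Y 1 \<omega> ^ 4)"
    using assms(10) Yf by (simp cong: Bochner_Integration.integrable_cong)
  have L_meas: "(\<lambda>\<omega>. \<Lambda> (Y 1 \<omega>)) \<in> borel_measurable M"
    using convex_measurable[of "Y 1" M J \<Lambda>] strongly_convex_imp_convex_on[OF sc J(2)] J YJ
      Y_indep by (auto simp: comp_def indep_vars_def)
  have "integrable M (\<lambda>\<omega>. \<bar>\<Lambda> (Y 1 \<omega>)\<bar>)"
    using assms(12) Yf \<Lambda>f assms(9) by (simp cong: Bochner_Integration.integrable_cong)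
  then have \<Lambda>Y: "integrable M (\<lambda>\<omega>. \<Lambda> (Y 1 \<omega>))"
    using L_meas by (rule integrable_abs_cancel)
  have moments: "central_moment M (Y 1) k = central_moment M (\<lambda>\<omega>. f (\<xi> 1 \<omega>)) k" for k
    unfolding central_moment_def using Yf by (simp cong: Bochner_Integration.integral_cong)
  have qam: "L (quasi_arith_mean I f n (\<lambda>i. \<xi> i \<omega>)) = \<Lambda> ((\<Sum>i = 1..n. Y i \<omega>) / real n)"
    if "\<omega> \<in> space M" for n \<omega>
    using Yf that by (simp add: quasi_arith_mean_def \<Lambda>_def)
  have main: "integrable M (\<lambda>\<omega>. L (quasi_arith_mean I f n (\<lambda>i. \<xi> i \<omega>)))"
      "integrable M (\<lambda>\<omega>. L (quasi_arith_mean I f (n - 1) (\<lambda>i. \<xi> i \<omega>)))"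
      "(\<integral>\<omega>. L (quasi_arith_mean I f n (\<lambda>i. \<xi> i \<omega>)) \<partial>M)
       \<le> (\<integral>\<omega>. L (quasi_arith_mean I f (n - 1) (\<lambda>i. \<xi> i \<omega>)) \<partial>M)
          - 1 / ((real n - 1) ^ 3 * real n ^ 3)
              * ((real n ^ 2 - 3 * real n + 3) * central_moment M (\<lambda>\<omega>. f (\<xi> 1 \<omega>)) 4
                 + 3 * (2 * real n - 3) * (central_moment M (\<lambda>\<omega>. f (\<xi> 1 \<omega>)) 2) ^ 2)"
    if "n \<ge> 2" for n
  proof -
    have "indep_vars (\<lambda>_. borel) Y {1..n}"
      by (rule indep_vars_subset[OF Y_indep]) auto
    note * = expectation_mean_decrease[OF J sc _ _ _ _ this Y_distr YJ _ Y4 \<Lambda>Y, where B = "{1..n - 1}",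
        unfolded moments]
    have r: "real (n - 1) = real n - 1" using that by simp
    show "integrable M (\<lambda>\<omega>. L (quasi_arith_mean I f n (\<lambda>i. \<xi> i \<omega>)))"
      "integrable M (\<lambda>\<omega>. L (quasi_arith_mean I f (n - 1) (\<lambda>i. \<xi> i \<omega>)))"
      "(\<integral>\<omega>. L (quasi_arith_mean I f n (\<lambda>i. \<xi> i \<omega>)) \<partial>M)
       \<le> (\<integral>\<omega>. L (quasi_arith_mean I f (n - 1) (\<lambda>i. \<xi> i \<omega>)) \<partial>M)
          - 1 / ((real n - 1) ^ 3 * real n ^ 3)
              * ((real n ^ 2 - 3 * real n + 3) * central_moment M (\<lambda>\<omega>. f (\<xi> 1 \<omega>)) 4
                 + 3 * (2 * real n - 3) * (central_moment M (\<lambda>\<omega>. f (\<xi> 1 \<omega>)) 2) ^ 2)"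
      using * that
      by (simp_all add: qam r cong: Bochner_Integration.integral_cong Bochner_Integration.integrable_cong)
  qed
  show ?thesis
  proof (intro conjI allI impI)
    fix n :: nat assume n: "n \<ge> 2"
    show "expectation_below_top M (\<lambda>\<omega>. L (quasi_arith_mean I f n (\<lambda>i. \<xi> i \<omega>)))"
      unfolding expectation_below_top_def using main(1)[OF n] by (auto intro!: integrable_max)
  next
    fix n :: nat assume n: "n \<ge> 2"
    show "ext_expectation M (\<lambda>\<omega>. L (quasi_arith_mean I f n (\<lambda>i. \<xi> i \<omega>)))
       \<le> ext_expectation M (\<lambda>\<omega>. L (quasi_arith_mean I f (n - 1) (\<lambda>i. \<xi> i \<omega>)))
          - ereal (1 / ((real n - 1) ^ 3 * real n ^ 3)
              * ((real n ^ 2 - 3 * real n + 3) * central_moment M (\<lambda>\<omega>. f (\<xi> 1 \<omega>)) 4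
                 + 3 * (2 * real n - 3) * (central_moment M (\<lambda>\<omega>. f (\<xi> 1 \<omega>)) 2) ^ 2))"
      using main(3)[OF n]
      unfolding ext_expectation_eq_integral[OF main(1)[OF n]]
        ext_expectation_eq_integral[OF main(2)[OF n]]
      by simp
  qed
qed

end
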